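(* Let $S\subset E^{3}$ be a fixed bounded space region of volume $V_S>0$ and $[t_1,t_2]$ a fixed time interval of length $T=t_2-t_1>0$, the same at every position and every moment of time, and let $$\langle f\rangle(x^{i},t)=\langle f(x^i,t)\rangle_{ST}=\frac{1}{TV_S}\int_{t_1}^{t_2}\int_{S} f(x^{i}+x'^{i},t+t')\,dV'\,dt'.$$ Let $u^i(x^j,t)$, $i=1,2,3$, be a smooth fluid velocity field and $f(x^i,t)$ a smooth fluid field on $E^3\times\mathbb{R}$. Then the space-time average of the material derivative of $f$ is $$\Big\langle\frac{df}{dt}\Big\rangle_{ST}=\Big\langle\frac{\partial f}{\partial t}+u^i\frac{\partial f}{\partial x^i}\Big\rangle_{ST}=\frac{d\langle f\rangle}{dt}+\Big\langle u^i\frac{\partial f}{\partial x^i}\Big\rangle-\langle u^i\rangle\frac{\partial\langle f\rangle}{\partial x^i},$$ where $\big\langle u^i\frac{\partial f}{\partial x^i}\big\rangle(x^j,t)=\big\langle u^i(x^j,t)\frac{\partial f(x^j,t)}{\partial x^i}\big\rangle_{ST}$ is the space-time average of the product.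
   Context: Repeated indices are summed over $1,2,3$. For an (unaveraged) field $f$ the material derivative is $\frac{df}{dt}=\frac{\partial f}{\partial t}+u^i\frac{\partial f}{\partial x^i}$. For an averaged field $\langle f\rangle$ the material derivative is taken along the averaged motion: $\frac{d\langle f\rangle}{dt}=\frac{\partial\langle f\rangle}{\partial t}+\langle u^i\rangle\frac{\partial\langle f\rangle}{\partial x^i}$. The region $S$ is bounded and measurable. *)

theory Defs
  imports "HOL-Analysis.Analysis"
begin

text \<open>
  A field on \<open>E\<^sup>3 \<times> \<real>\<close> is a curried function of the position in \<^typ>\<open>real^3\<close> and the time.
\<close>

text \<open>
  \<open>Ck k g\<close>: \<open>g\<close> is \<open>k\<close> times continuously differentiable on the whole space.
\<close>

primrec Ck :: "nat \<Rightarrow> ('a::euclidean_space \<Rightarrow> 'b::real_normed_vector) \<Rightarrow> bool" where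
  "Ck 0 g \<longleftrightarrow> continuous_on UNIV g"
| "Ck (Suc k) g \<longleftrightarrow> (\<forall>p. g differentiable (at p)) \<and>
     (\<forall>b\<in>Basis. Ck k (\<lambda>p. frechet_derivative g (at p) b))"

definition smooth_field :: "(real^3 \<Rightarrow> real \<Rightarrow> 'b::real_normed_vector) \<Rightarrow> bool" where
  "smooth_field f \<longleftrightarrow> (\<forall>k. Ck k (\<lambda>(x, t). f x t))"

definition dt :: "(real^3 \<Rightarrow> real \<Rightarrow> real) \<Rightarrow> real^3 \<Rightarrow> real \<Rightarrow> real" where
  "dt f x t = deriv (\<lambda>s. f x s) t"

definition dx :: "3 \<Rightarrow> (real^3 \<Rightarrow> real \<Rightarrow> real) \<Rightarrow> real^3 \<Rightarrow> real \<Rightarrow> real" where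
  "dx i f x t = deriv (\<lambda>h. f (x + h *\<^sub>R axis i 1) t) 0"

definition material_deriv ::
    "(real^3 \<Rightarrow> real \<Rightarrow> real^3) \<Rightarrow> (real^3 \<Rightarrow> real \<Rightarrow> real) \<Rightarrow> real^3 \<Rightarrow> real \<Rightarrow> real" where
  "material_deriv u f x t = dt f x t + (\<Sum>i\<in>UNIV. u x t $ i * dx i f x t)"

text \<open>
  The time shift ranges over the interval from \<open>t1\<close> to \<open>t2\<close> itself, so the average at \<open>(x, t)\<close> is taken
  over \<open>x + S\<close> and over the times between \<open>t + t1\<close> and \<open>t + t2\<close>.
\<close>

definition st_avg ::
    "(real^3) set \<Rightarrow> real \<Rightarrow> real \<Rightarrow> (real^3 \<Rightarrow> real \<Rightarrow> real) \<Rightarrow> real^3 \<Rightarrow> real \<Rightarrow> real" where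
  "st_avg S t1 t2 f x t =
     1 / ((t2 - t1) * measure lebesgue S) *
     (LINT t':{t1..t2}|lebesgue. (LINT x':S|lebesgue. f (x + x') (t + t')))"

definition st_avg_vec ::
    "(real^3) set \<Rightarrow> real \<Rightarrow> real \<Rightarrow> (real^3 \<Rightarrow> real \<Rightarrow> real^3) \<Rightarrow> real^3 \<Rightarrow> real \<Rightarrow> real^3" where
  "st_avg_vec S t1 t2 u x t = (\<chi> i. st_avg S t1 t2 (\<lambda>y s. u y s $ i) x t)"

end

theory Submission
  imports Defs
begin

text \<open>
  Averaging commutes with \<open>\<partial>/\<partial>t\<close> and \<open>\<partial>/\<partial>x\<^sup>i\<close>: on the compact closure of a bounded set the
  difference quotients of a continuously differentiable integrand converge uniformly, by the mean
  value theorem. The averaged products \<open>\<langle>u\<^sup>i\<rangle> \<partial>\<langle>f\<rangle>/\<partial>x\<^sup>i\<close> are added and subtracted again, so only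
  linearity and \<open>\<langle>\<partial>f/\<partial>t\<rangle> = \<partial>\<langle>f\<rangle>/\<partial>t\<close> remain.
\<close>

section \<open>Integrals of continuous functions over bounded measurable sets, with and without a
  parameter\<close>

lemma continuous_on_uncurried_compose:
  assumes "continuous_on UNIV (\<lambda>(x, y). k x y)" "continuous_on A a" "continuous_on A b"
  shows "continuous_on A (\<lambda>p. k (a p) (b p))"
  using continuous_on_compose2[OF assms(1) continuous_on_Pair[OF assms(2,3)]] by simp

text \<open>The closure of \<open>S\<close> is compact, so a continuous function is Borel integrable
  there. Integrability survives the passage to the completed measure and then to the subset
  \<open>S\<close>, which may be Lebesgue but not Borel measurable.\<close>

lemma set_integrable_lebesgue_bounded_continuous:
  fixes g :: "'a::euclidean_space \<Rightarrow> real"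
  assumes "bounded S" "S \<in> sets lebesgue" "continuous_on UNIV g"
  shows "set_integrable lebesgue S g"
proof -
  have "set_integrable lborel (closure S) g"
    unfolding set_integrable_def
    using assms by (intro borel_integrable_compact) (auto intro: continuous_on_subset)
  then have "set_integrable lebesgue (closure S) g"
    unfolding set_integrable_def by (simp add: integrable_completion borel_measurable_integrable)
  then show ?thesis
    by (rule set_integrable_subset) (use assms closure_subset in auto)
qed

text \<open>Converts a uniform pointwise estimate into the closing estimate of the two limit
  arguments for integrals with a parameter.\<close>

lemma set_integral_lebesgue_abs_le:
  fixes g :: "'a::euclidean_space \<Rightarrow> real"
  assumes "bounded S" "S \<in> sets lebesgue" "continuous_on UNIV g"
    and "\<And>x. x \<in> S \<Longrightarrow> \<bar>g x\<bar> \<le> e"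
  shows "\<bar>LINT x:S|lebesgue. g x\<bar> \<le> e * measure lebesgue S"
proof -
  have fin: "emeasure lebesgue S < \<infinity>"
    using bounded_set_imp_lmeasurable[OF assms(1,2)] unfolding fmeasurable_def by auto
  have ic: "set_integrable lebesgue S (\<lambda>_. e)"
    by (rule set_integrable_lebesgue_bounded_continuous) (use assms in auto)
  have "\<bar>LINT x:S|lebesgue. g x\<bar> \<le> (LINT x:S|lebesgue. \<bar>g x\<bar>)"
    using set_integral_norm_bound[OF set_integrable_lebesgue_bounded_continuous[OF assms(1-3)]]
    by simp
  also have "\<dots> \<le> (LINT x:S|lebesgue. e)"
    by (rule set_integral_mono)
      (use assms ic in \<open>auto intro!: set_integrable_lebesgue_bounded_continuous continuous_intros\<close>)
  also have "\<dots> = e * measure lebesgue S"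
    using assms(2) fin by (simp add: set_lebesgue_integral_def)
  finally show ?thesis .
qed

lemma continuous_on_set_integral_param:
  fixes G :: "'p::topological_space \<Rightarrow> 'a::euclidean_space \<Rightarrow> real"
  assumes S: "bounded S" "S \<in> sets lebesgue"
    and G: "continuous_on UNIV (\<lambda>(p, x). G p x)"
  shows "continuous_on UNIV (\<lambda>p. LINT x:S|lebesgue. G p x)"
proof -
  have Gp: "continuous_on UNIV (G p)" for p
    by (rule continuous_on_uncurried_compose[OF G]) (auto intro: continuous_intros)
  have "((\<lambda>p. LINT x:S|lebesgue. G p x) \<longlongrightarrow> (LINT x:S|lebesgue. G p0 x)) (nhds p0)" for p0
  proof (rule tendstoI)
    fix e :: real assume "e > 0"
    \<comment> \<open>The added 1 keeps the denominator positive when \<open>S\<close> is a null set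
      and makes \<open>d * measure lebesgue S\<close> strictly smaller than
      \<open>e\<close>.\<close>
    define d where "d = e / (measure lebesgue S + 1)"
    have "d > 0" using \<open>e > 0\<close> by (simp add: d_def add_nonneg_pos)
    have "d * measure lebesgue S < d * (measure lebesgue S + 1)"
      using \<open>d > 0\<close> by simp
    also have "\<dots> = e"
      using add_nonneg_pos[of "measure lebesgue S" 1] by (simp add: d_def)
    finally have de: "d * measure lebesgue S < e" .
    \<comment> \<open>Tube argument: compactness of the closure gives one neighbourhood of
      \<open>p0\<close> that serves all \<open>x\<close> at once. No metric on the parameter space
      is involved.\<close>
    obtain X0 where X0: "p0 \<in> X0" "open X0"
      "\<forall>p\<in>X0 \<inter> UNIV. \<forall>x\<in>closure S. dist ((\<lambda>(p, x). G p x) (p, x)) ((\<lambda>(p, x). G p x) (p0, x)) \<le> d"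
      by (rule continuous_on_prod_compactE[of UNIV "closure S" "\<lambda>(p, x). G p x" p0 d])
        (use G S \<open>d > 0\<close> in \<open>auto intro: continuous_on_subset\<close>)
    have "dist (LINT x:S|lebesgue. G p x) (LINT x:S|lebesgue. G p0 x) < e" if "p \<in> X0" for p
    proof -
      have "\<bar>LINT x:S|lebesgue. G p x - G p0 x\<bar> \<le> d * measure lebesgue S"
        using that X0(3) closure_subset[of S]
        by (intro set_integral_lebesgue_abs_le) (auto intro!: S continuous_intros Gp simp: dist_real_def)
      then show ?thesis
        using de by (simp add: dist_real_def set_integral_diff(2) S Gp
            set_integrable_lebesgue_bounded_continuous)
    qed
    then show "\<forall>\<^sub>F p in nhds p0. dist (LINT x:S|lebesgue. G p x) (LINT x:S|lebesgue. G p0 x) < e"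
      using X0(1,2) eventually_nhds by blast
  qed
  then show ?thesis
    by (auto simp: continuous_on_def intro: tendsto_mono[OF at_le] filterlim_mono at_within_le_nhds)
qed

text \<open>By the mean value theorem each difference quotient is a value \<open>G' z x\<close>,
  with \<open>z\<close> between \<open>h0\<close> and \<open>h\<close> depending on
  \<open>x\<close>. The tube argument bounds its distance from \<open>G' h0 x\<close> uniformly in
  \<open>x\<close>, so \<open>z\<close> is never integrated and need not be chosen
  measurably.\<close>

lemma has_real_derivative_set_integral:
  fixes G G' :: "real \<Rightarrow> 'a::euclidean_space \<Rightarrow> real"
  assumes S: "bounded S" "S \<in> sets lebesgue"
    and deriv: "\<And>h x. ((\<lambda>h. G h x) has_real_derivative G' h x) (at h)"
    and G: "\<And>h. continuous_on UNIV (G h)"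
    and G': "continuous_on UNIV (\<lambda>(h, x). G' h x)"
  shows "((\<lambda>h. LINT x:S|lebesgue. G h x) has_real_derivative (LINT x:S|lebesgue. G' h0 x)) (at h0)"
proof -
  have Gp': "continuous_on UNIV (G' h)" for h
    by (rule continuous_on_uncurried_compose[OF G']) (auto intro: continuous_intros)
  let ?I = "\<lambda>h. LINT x:S|lebesgue. G h x"
  let ?D = "LINT x:S|lebesgue. G' h0 x"
  have "((\<lambda>h. (?I h - ?I h0) / (h - h0)) \<longlongrightarrow> ?D) (at h0)"
  proof (rule tendstoI)
    fix e :: real assume "e > 0"
    define d where "d = e / (measure lebesgue S + 1)"
    have "d > 0" using \<open>e > 0\<close> by (simp add: d_def add_nonneg_pos)
    have "d * measure lebesgue S < d * (measure lebesgue S + 1)"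
      using \<open>d > 0\<close> by simp
    also have "\<dots> = e"
      using add_nonneg_pos[of "measure lebesgue S" 1] by (simp add: d_def)
    finally have de: "d * measure lebesgue S < e" .
    obtain X0 where X0: "h0 \<in> X0" "open X0"
      "\<forall>p\<in>X0 \<inter> UNIV. \<forall>x\<in>closure S. dist ((\<lambda>(p, x). G' p x) (p, x)) ((\<lambda>(p, x). G' p x) (h0, x)) \<le> d"
      by (rule continuous_on_prod_compactE[of UNIV "closure S" "\<lambda>(p, x). G' p x" h0 d])
        (use G' S \<open>d > 0\<close> in \<open>auto intro: continuous_on_subset\<close>)
    then obtain r where r: "r > 0" "ball h0 r \<subseteq> X0" by (meson open_contains_ball)
    have "dist ((?I h - ?I h0) / (h - h0)) ?D < e" if h: "h \<noteq> h0" "dist h h0 < r" for h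
    proof -
      have pt: "\<bar>(G h x - G h0 x) / (h - h0) - G' h0 x\<bar> \<le> d" if "x \<in> S" for x
      proof -
        \<comment> \<open>\<open>MVT2\<close> expects ordered endpoints, hence the two cases; the
          signed formula for the increment is the same in both.\<close>
        obtain z where z: "\<bar>z - h0\<bar> \<le> \<bar>h - h0\<bar>" "G h x - G h0 x = (h - h0) * G' z x"
        proof (cases "h0 < h")
          case True
          with MVT2[of h0 h "\<lambda>h. G h x" "\<lambda>h. G' h x"] deriv obtain z
            where "h0 < z" "z < h" "G h x - G h0 x = (h - h0) * G' z x" by blast
          then show ?thesis by (intro that[of z]) auto
        next
          case False
          with h(1) have "h < h0" by simp
          with MVT2[of h h0 "\<lambda>h. G h x" "\<lambda>h. G' h x"] deriv obtain z
            where "h < z" "z < h0" "G h0 x - G h x = (h0 - h) * G' z x" by blast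
          then show ?thesis by (intro that[of z]) (auto simp: algebra_simps)
        qed
        then have "z \<in> X0" using r(2) h(2) by (auto simp: dist_real_def abs_minus_commute)
        then have "\<bar>G' z x - G' h0 x\<bar> \<le> d"
          using X0(3) that closure_subset[of S] by (auto simp: dist_real_def)
        then show ?thesis using z(2) h(1) by simp
      qed
      have i: "set_integrable lebesgue S (G h)" "set_integrable lebesgue S (G h0)"
        "set_integrable lebesgue S (G' h0)"
        by (auto intro!: set_integrable_lebesgue_bounded_continuous S G Gp')
      have "\<bar>LINT x:S|lebesgue. (G h x - G h0 x) / (h - h0) - G' h0 x\<bar> \<le> d * measure lebesgue S"
        using h(1) by (intro set_integral_lebesgue_abs_le pt)
          (auto intro!: S continuous_intros G Gp')
      also have "(LINT x:S|lebesgue. (G h x - G h0 x) / (h - h0) - G' h0 x) = (?I h - ?I h0) / (h - h0) - ?D"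
        using i by (simp add: set_integral_diff set_integrable_divide)
      finally show ?thesis using de by (simp add: dist_real_def)
    qed
    then show "\<forall>\<^sub>F h in at h0. dist ((?I h - ?I h0) / (h - h0)) ?D < e"
      using r(1) by (auto simp: eventually_at)
  qed
  then show ?thesis by (simp add: has_field_derivative_iff)
qed

section \<open>Additivity and differentiation of the space-time average\<close>

lemma st_avg_add:
  assumes S: "bounded S" "S \<in> sets lebesgue"
    and f: "continuous_on UNIV (\<lambda>(x, t). f x t)" and g: "continuous_on UNIV (\<lambda>(x, t). g x t)"
  shows "st_avg S t1 t2 (\<lambda>y s. f y s + g y s) x t = st_avg S t1 t2 f x t + st_avg S t1 t2 g x t"
proof -
  have inner: "set_integrable lebesgue S (\<lambda>x'. k (x + x') (t + t'))"
    if "continuous_on UNIV (\<lambda>(x, t). k x t)" for k :: "real^3 \<Rightarrow> real \<Rightarrow> real" and t'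
    by (rule set_integrable_lebesgue_bounded_continuous[OF S continuous_on_uncurried_compose[OF that]])
      (auto intro: continuous_intros)
  \<comment> \<open>The inner integral depends continuously on \<open>t'\<close>, so the
    integrability criterion applies again on the bounded time interval.\<close>
  have outer: "set_integrable lebesgue {t1..t2} (\<lambda>t'. LINT x':S|lebesgue. k (x + x') (t + t'))"
    if "continuous_on UNIV (\<lambda>(x, t). k x t)" for k :: "real^3 \<Rightarrow> real \<Rightarrow> real"
    by (intro set_integrable_lebesgue_bounded_continuous continuous_on_set_integral_param S)
      (auto intro!: continuous_intros continuous_on_uncurried_compose[OF that] simp: case_prod_unfold)
  show ?thesis
    by (simp add: st_avg_def set_integral_add inner outer f g distrib_left)
qed

text \<open>A general space-time direction \<open>(v, w)\<close> treats time and space derivatives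
  together. Moving the base point commutes with the shifts by \<open>x'\<close> and
  \<open>t'\<close>, so differentiation under the integral can be used twice, over \<open>S\<close>
  and over \<open>{t1..t2}\<close>.\<close>

lemma has_real_derivative_st_avg:
  assumes S: "bounded S" "S \<in> sets lebesgue"
    and f: "continuous_on UNIV (\<lambda>(x, t). f x t)" and g: "continuous_on UNIV (\<lambda>(x, t). g x t)"
    and deriv: "\<And>x t. ((\<lambda>h. f (x + h *\<^sub>R v) (t + h * w)) has_real_derivative g x t) (at 0)"
  shows "((\<lambda>h. st_avg S t1 t2 f (x + h *\<^sub>R v) (t + h * w)) has_real_derivative
    st_avg S t1 t2 g x t) (at 0)"
proof -
  \<comment> \<open>The assumption concerns only \<open>h = 0\<close>, but at every base point;
    moving the base point along the line yields the derivative at every \<open>h\<close>.\<close>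
  have deriv': "((\<lambda>h. f (x + h *\<^sub>R v) (t + h * w)) has_real_derivative
      g (x + h *\<^sub>R v) (t + h * w)) (at h)" for x t h
    using deriv[of "x + h *\<^sub>R v" "t + h * w"] DERIV_shift[of "\<lambda>h. f (x + h *\<^sub>R v) (t + h * w)" _ 0 h]
    by (simp add: algebra_simps)
  \<comment> \<open>The terms with factor 0 exhibit the derivative as the member at
    \<open>h = 0\<close> of the family \<open>G'\<close> in the rule applied next.\<close>
  have "((\<lambda>h. LINT t':{t1..t2}|lebesgue. LINT x':S|lebesgue. f (x + h *\<^sub>R v + x') (t + h * w + t'))
      has_real_derivative
      (LINT t':{t1..t2}|lebesgue. LINT x':S|lebesgue. g (x + 0 *\<^sub>R v + x') (t + 0 * w + t'))) (at 0)"
  proof (rule has_real_derivative_set_integral)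
    fix h t'
    show "((\<lambda>h. LINT x':S|lebesgue. f (x + h *\<^sub>R v + x') (t + h * w + t')) has_real_derivative
      (LINT x':S|lebesgue. g (x + h *\<^sub>R v + x') (t + h * w + t'))) (at h)"
    proof (rule has_real_derivative_set_integral[OF S])
      show "((\<lambda>h. f (x + h *\<^sub>R v + x') (t + h * w + t')) has_real_derivative
        g (x + h *\<^sub>R v + x') (t + h * w + t')) (at h)" for h x'
        using deriv'[of "x + x'" "t + t'" h] by (simp add: algebra_simps)
    qed (auto simp: case_prod_unfold intro!: continuous_on_uncurried_compose[OF f]
        continuous_on_uncurried_compose[OF g] continuous_intros)
  next
    show "continuous_on UNIV (\<lambda>t'. LINT x':S|lebesgue. f (x + h *\<^sub>R v + x') (t + h * w + t'))" for h
      by (intro continuous_on_set_integral_param S)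
        (auto simp: case_prod_unfold intro!: continuous_on_uncurried_compose[OF f] continuous_intros)
  next
    \<comment> \<open>The outer differentiation requires joint continuity in \<open>h\<close> and
      \<open>t'\<close>, so the pair \<open>p\<close> serves as the parameter of the inner
      integral.\<close>
    have "continuous_on UNIV (\<lambda>p. LINT x':S|lebesgue. g (x + fst p *\<^sub>R v + x') (t + fst p * w + snd p))"
      by (intro continuous_on_set_integral_param S)
        (auto simp: case_prod_unfold intro!: continuous_on_uncurried_compose[OF g] continuous_intros)
    then show "continuous_on UNIV
      (\<lambda>(h, t'). LINT x':S|lebesgue. g (x + h *\<^sub>R v + x') (t + h * w + t'))"
      by (simp add: case_prod_unfold)
  qed auto
  then show ?thesis
    unfolding st_avg_def by (intro DERIV_cmult) simp
qed

section \<open>Partial derivatives of smooth fields\<close>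

lemma smooth_field_continuous: "smooth_field f \<Longrightarrow> continuous_on UNIV (\<lambda>(x, t). f x t)"
  unfolding smooth_field_def using Ck.simps(1) by blast

text \<open>Links the Frechet derivatives in \<open>Ck\<close> to one-variable derivatives:
  evaluation at a basis vector is continuous in the base point, and the chain rule along a line
  identifies it with the derivative in that direction.\<close>

lemma smooth_field_directional_derivative:
  fixes f :: "real^3 \<Rightarrow> real \<Rightarrow> real"
  assumes "smooth_field f" "(v, w) \<in> Basis"
  obtains g where "continuous_on UNIV (\<lambda>(x, t). g x t)"
    "\<And>x t. ((\<lambda>h. f (x + h *\<^sub>R v) (t + h * w)) has_real_derivative g x t) (at 0)"
proof
  let ?F = "\<lambda>(x, t). f x t"
  have "Ck (Suc 0) ?F" using assms(1) by (simp only: smooth_field_def)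
  then have diff: "?F differentiable (at p)"
    and cont: "continuous_on UNIV (\<lambda>p. frechet_derivative ?F (at p) (v, w))" for p
    using assms(2) unfolding Ck.simps by blast+
  show "continuous_on UNIV (\<lambda>(x, t). frechet_derivative ?F (at (x, t)) (v, w))"
    using cont by (simp add: case_prod_unfold)
  fix x t
  have "(?F has_derivative frechet_derivative ?F (at (x, t))) (at (x, t))"
    using diff frechet_derivative_works by blast
  \<comment> \<open>The base point is written as the value of the line at \<open>h = 0\<close>, the
    form that the chain rule expects.\<close>
  then have F: "(?F has_derivative frechet_derivative ?F (at (x, t))) (at (x + 0 *\<^sub>R v, t + 0 * w))"
    by simp
  have line: "((\<lambda>h. (x + h *\<^sub>R v, t + h * w)) has_derivative (\<lambda>h. (h *\<^sub>R v, h * w))) (at 0)"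
    by (auto intro!: derivative_eq_intros)
  have "((\<lambda>h. f (x + h *\<^sub>R v) (t + h * w)) has_derivative
      (\<lambda>h. frechet_derivative ?F (at (x, t)) (h *\<^sub>R v, h * w))) (at 0)"
    using has_derivative_compose[OF line F] by simp
  moreover have "frechet_derivative ?F (at (x, t)) (h *\<^sub>R v, h * w) =
      frechet_derivative ?F (at (x, t)) (v, w) * h" for h
    using linear_scale[OF linear_frechet_derivative[OF diff], of "(x, t)" h "(v, w)"]
    by (simp add: mult.commute)
  ultimately show "((\<lambda>h. f (x + h *\<^sub>R v) (t + h * w)) has_real_derivative
      frechet_derivative ?F (at (x, t)) (v, w)) (at 0)"
    by (simp add: has_field_derivative_def)
qed

text \<open>Since \<open>deriv\<close> is informative only where a derivative exists, existence
  comes first, from the direction \<open>(0, 1)\<close>; uniqueness then identifies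
  \<open>dt f\<close> with the continuous \<open>g\<close>.\<close>

lemma smooth_field_dt:
  assumes "smooth_field f"
  shows "continuous_on UNIV (\<lambda>(x, t). dt f x t)"
    and "((\<lambda>s. f x s) has_real_derivative dt f x t) (at t)"
proof -
  have "(0 :: real^3, 1 :: real) \<in> Basis" by (simp add: Basis_prod_def)
  from smooth_field_directional_derivative[OF assms this] obtain g where
    g: "continuous_on UNIV (\<lambda>(x, t). g x t)"
      "\<And>x t. ((\<lambda>h. f x (t + h)) has_real_derivative g x t) (at 0)"
    by auto
  have D: "((\<lambda>s. f x s) has_real_derivative g x t) (at t)" for x t
    using g(2)[of x t] DERIV_shift[of "f x" "g x t" 0 t] by (simp add: add.commute)
  then have "dt f = g" by (auto simp: dt_def fun_eq_iff intro: DERIV_imp_deriv)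
  with g(1) D show "continuous_on UNIV (\<lambda>(x, t). dt f x t)"
    and "((\<lambda>s. f x s) has_real_derivative dt f x t) (at t)" by auto
qed

lemma smooth_field_dx:
  assumes "smooth_field f"
  shows "continuous_on UNIV (\<lambda>(x, t). dx i f x t)"
    and "((\<lambda>h. f (x + h *\<^sub>R axis i 1) t) has_real_derivative dx i f x t) (at 0)"
proof -
  have "(axis i 1 :: real^3, 0 :: real) \<in> Basis" by (simp add: Basis_prod_def axis_in_Basis_iff)
  from smooth_field_directional_derivative[OF assms this] obtain g where
    g: "continuous_on UNIV (\<lambda>(x, t). g x t)"
      "\<And>x t. ((\<lambda>h. f (x + h *\<^sub>R axis i 1) t) has_real_derivative g x t) (at 0)"
    by auto
  then have "dx i f = g" by (auto simp: dx_def fun_eq_iff intro: DERIV_imp_deriv)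
  with g show "continuous_on UNIV (\<lambda>(x, t). dx i f x t)"
    and "((\<lambda>h. f (x + h *\<^sub>R axis i 1) t) has_real_derivative dx i f x t) (at 0)" by auto
qed

section \<open>Time and space derivatives of the averaged field\<close>

lemma has_real_derivative_st_avg_time:
  assumes "bounded S" "S \<in> sets lebesgue" "smooth_field f"
  shows "((\<lambda>s. st_avg S t1 t2 f x s) has_real_derivative st_avg S t1 t2 (dt f) x t) (at t)"
proof -
  \<comment> \<open>Pure time translation is the direction \<open>v = 0\<close>,
    \<open>w = 1\<close>; \<open>DERIV_shift\<close> converts between increments at 0 and times at
    \<open>t\<close>.\<close>
  have "((\<lambda>h. f (x + h *\<^sub>R 0) (t + h * 1)) has_real_derivative dt f x t) (at 0)" for x t
    using smooth_field_dt(2)[OF assms(3), of x t] DERIV_shift[of "f x" "dt f x t" 0 t]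
    by (simp add: add.commute)
  from has_real_derivative_st_avg[OF assms(1,2) smooth_field_continuous[OF assms(3)]
      smooth_field_dt(1)[OF assms(3)] this, of t1 t2 x t]
  show ?thesis
    using DERIV_shift[of "st_avg S t1 t2 f x" "st_avg S t1 t2 (dt f) x t" 0 t]
    by (simp add: add.commute)
qed

lemma has_real_derivative_st_avg_space:
  assumes "bounded S" "S \<in> sets lebesgue" "smooth_field f"
  shows "((\<lambda>h. st_avg S t1 t2 f (x + h *\<^sub>R axis i 1) t) has_real_derivative
    st_avg S t1 t2 (dx i f) x t) (at 0)"
  using has_real_derivative_st_avg[OF assms(1,2) smooth_field_continuous[OF assms(3)]
      smooth_field_dx(1)[OF assms(3)], of "axis i 1" 0 i t1 t2 x t]
    smooth_field_dx(2)[OF assms(3)]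
  by simp

text \<open>The differentiability clauses ensure that the partial derivatives of the averaged field
  are genuine, since \<open>deriv\<close> is a total operator.\<close>

theorem theorem4:
  fixes S :: "(real^3) set" and t1 t2 :: real
    and u :: "real^3 \<Rightarrow> real \<Rightarrow> real^3" and f :: "real^3 \<Rightarrow> real \<Rightarrow> real"
    and x :: "real^3" and t :: real
  assumes "bounded S" and "S \<in> sets lebesgue" and "measure lebesgue S > 0"
    and "t1 < t2"
    and "smooth_field u" and "smooth_field f"
  shows
    "(\<lambda>s. st_avg S t1 t2 f x s) field_differentiable (at t) \<and>
     (\<forall>i. (\<lambda>h. st_avg S t1 t2 f (x + h *\<^sub>R axis i 1) t) field_differentiable (at 0)) \<and>
     st_avg S t1 t2 (material_deriv u f) x t =
       st_avg S t1 t2 (\<lambda>y s. dt f y s + (\<Sum>i\<in>UNIV. u y s $ i * dx i f y s)) x t \<and>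
     st_avg S t1 t2 (\<lambda>y s. dt f y s + (\<Sum>i\<in>UNIV. u y s $ i * dx i f y s)) x t =
       material_deriv (st_avg_vec S t1 t2 u) (st_avg S t1 t2 f) x t
       + st_avg S t1 t2 (\<lambda>y s. \<Sum>i\<in>UNIV. u y s $ i * dx i f y s) x t
       - (\<Sum>i\<in>UNIV. st_avg_vec S t1 t2 u x t $ i * dx i (st_avg S t1 t2 f) x t)"
proof -
  have time: "((\<lambda>s. st_avg S t1 t2 f x s) has_real_derivative st_avg S t1 t2 (dt f) x t) (at t)"
    using assms by (intro has_real_derivative_st_avg_time)
  have "continuous_on UNIV (\<lambda>p. u (fst p) (snd p))"
    and "continuous_on UNIV (\<lambda>p. dx i f (fst p) (snd p))" for i
    using smooth_field_continuous[OF assms(5)] smooth_field_dx(1)[OF assms(6)]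
    by (simp_all add: case_prod_unfold)
  then have "continuous_on UNIV (\<lambda>(y, s). \<Sum>i\<in>UNIV. u y s $ i * dx i f y s)"
    by (auto simp: case_prod_unfold intro!: continuous_intros)
  note add = st_avg_add[OF assms(1,2) smooth_field_dt(1)[OF assms(6)] this]
  \<comment> \<open>The only exchange of averaging and differentiation that enters the identity: the
    convective sum inside the outer \<open>material_deriv\<close> cancels against the subtracted one
    whatever its value. The space derivatives of the average serve the differentiability
    clause.\<close>
  have "dt (st_avg S t1 t2 f) x t = st_avg S t1 t2 (dt f) x t"
    using DERIV_imp_deriv[OF time] by (simp add: dt_def)
  moreover have "material_deriv u f = (\<lambda>y s. dt f y s + (\<Sum>i\<in>UNIV. u y s $ i * dx i f y s))"
    by (simp add: fun_eq_iff material_deriv_def)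
  moreover have "(\<lambda>h. st_avg S t1 t2 f (x + h *\<^sub>R axis i 1) t) field_differentiable (at 0)" for i
    using has_real_derivative_st_avg_space[OF assms(1,2,6)]
    unfolding field_differentiable_def by blast
  moreover have "(\<lambda>s. st_avg S t1 t2 f x s) field_differentiable (at t)"
    using time unfolding field_differentiable_def by blast
  ultimately show ?thesis
    by (simp add: add material_deriv_def)
qed

end
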